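(* Let $n\ge0$. For every polynomial $c(x)$ of degree at most $n$, putting $d=U_n^{-1}c$, one has $$U_n\big(d(-x-1)\big)=(-1)^n x^n c(1/x).$$ In matrix form: $U_nE(1,-x)U_n^{-1}=(-1)^nJ_n$, where $E$ is the shift $c(x)\mapsto c(x+1)$, $(1,-x)$ is $c(x)\mapsto c(-x)$, and $J_n c(x)=x^nc(1/x)$.
   Context: Polynomials are over $\mathbb{C}$; $\mathcal P_n$ denotes the space of polynomials of degree at most $n$. Write $(y)_p=y(y-1)\cdots(y-p+1)$ and $[y]_k=y(y+1)\cdots(y+k-1)$ (empty products equal $1$). $U_n$ is the linear map on $\mathcal P_n$ defined by $U_nx^p=\frac{(1-x)^{n+1}}{n!}\sum_{m\ge0}m^px^m$ for $0\le p\le n$ (with $0^0=1$); it is invertible with $U_n^{-1}x^p=(x)_p[x+1]_{n-p}$. *)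

theory Defs
  imports
    "HOL-Computational_Algebra.Polynomial_FPS"
    "HOL.Complex"
    "Jordan_Normal_Form.Matrix"
begin

hide_const (open) module.smult

definition poly_le :: "nat \<Rightarrow> complex poly set" where
  "poly_le n = {c. degree c \<le> n}"

text \<open>The operator \<open>U\<^sub>n\<close> on a monomial \<open>x\<^sup>p\<close>. The series is read as a formal power series,
  and \<open>THE\<close> picks the polynomial that it represents; for \<open>p \<le> n\<close> this polynomial exists
  (lemma \<open>fps_of_poly_U_monom\<close>). The convention \<open>0 ^ 0 = 1\<close> is built into the power operator.\<close>

definition U_monom :: "nat \<Rightarrow> nat \<Rightarrow> complex poly" where
  "U_monom n p = (THE q. fps_of_poly q =
     fps_const (1 / fact n) * (1 - fps_X) ^ (n + 1) * Abs_fps (\<lambda>m. of_nat m ^ p))"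

definition U :: "nat \<Rightarrow> complex poly \<Rightarrow> complex poly" where
  "U n c = (\<Sum>p\<le>n. smult (coeff c p) (U_monom n p))"

text \<open>Meaningful on \<^term>\<open>poly_le n\<close> only, where \<^term>\<open>U n\<close> is bijective (lemma \<open>bij_betw_U\<close>).\<close>

definition U_inv :: "nat \<Rightarrow> complex poly \<Rightarrow> complex poly" where
  "U_inv n = inv_into (poly_le n) (U n)"

definition shift :: "complex poly \<Rightarrow> complex poly" where
  "shift c = pcompose c [:1, 1:]"

definition neg_arg :: "complex poly \<Rightarrow> complex poly" where
  "neg_arg c = pcompose c [:0, -1:]"

text \<open>\<open>x\<^sup>n c(1/x)\<close> as a polynomial (see lemma \<open>poly_J\<close>).\<close>

definition J :: "nat \<Rightarrow> complex poly \<Rightarrow> complex poly" where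
  "J n c = (\<Sum>p\<le>n. monom (coeff c p) (n - p))"

text \<open>Matrix of an operator on \<^term>\<open>poly_le n\<close> in the basis \<open>1, x, \<dots>, x\<^sup>n\<close>: column \<open>j\<close>
  lists the coefficients of the image of \<open>x\<^sup>j\<close>, so the matrix acts on column vectors and
  products of matrices correspond to compositions applied from right to left.\<close>

definition op_mat :: "nat \<Rightarrow> (complex poly \<Rightarrow> complex poly) \<Rightarrow> complex mat" where
  "op_mat n T = mat (n + 1) (n + 1) (\<lambda>(i, j). coeff (T (monom 1 j)) i)"


lemma poly_eq_sum_atMost:
  fixes c :: "complex poly"
  assumes "degree c \<le> n"
  shows "poly c x = (\<Sum>p\<le>n. coeff c p * x ^ p)"
  by (subst poly_as_sum_of_monoms'[OF assms, symmetric]) (simp add: poly_sum poly_monom)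

lemma poly_J:
  assumes "c \<in> poly_le n" "x \<noteq> 0"
  shows "poly (J n c) x = x ^ n * poly c (1 / x)"
proof -
  have "poly c (1 / x) = (\<Sum>p\<le>n. coeff c p * (1 / x) ^ p)"
    using assms(1) by (intro poly_eq_sum_atMost) (simp add: poly_le_def)
  then show ?thesis using assms(2)
    by (auto simp: J_def poly_sum poly_monom sum_distrib_left power_diff field_simps intro!: sum.cong)
qed

lemma generating_function_poly:
  fixes d :: "complex poly"
  assumes "degree d \<le> n"
  shows "\<exists>q. degree q \<le> n \<and>
    fps_of_poly q = (1 - fps_X) ^ (n + 1) * Abs_fps (\<lambda>m. poly d (of_nat m))"
  using assms
proof (induction n arbitrary: d)
  case 0
  then obtain a where d: "d = [:a:]" by (auto elim: degree_eq_zeroE)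
  have "fps_of_poly [:a:] = (1 - fps_X) * Abs_fps (\<lambda>m. a)"
    by (rule fps_ext) (auto simp: left_diff_distrib coeff_pCons split: nat.splits)
  then show ?case by (intro exI[of _ "[:a:]"]) (simp add: d)
next
  case (Suc n)
  define e where "e = pcompose d [:1, 1:] - d"
  have deg: "degree (pcompose d [:1, 1:]) = degree d"
    by (simp add: degree_pcompose)
  have lc: "coeff (pcompose d [:1, 1:]) (degree d) = coeff d (degree d)"
    using lead_coeff_comp[of "[:1, 1:]" d] unfolding deg by simp
  have "degree e \<le> n"
  proof (rule degree_le, intro allI impI)
    fix i assume i: "n < i"
    show "coeff e i = 0"
    proof (cases "i = degree d")
      case True then show ?thesis using lc by (simp add: e_def)
    next
      case False
      then have "degree d < i" using Suc.prems i by simp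
      then show ?thesis using deg by (simp add: e_def coeff_eq_0)
    qed
  qed
  from Suc.IH[OF this] obtain q where q: "degree q \<le> n"
    "fps_of_poly q = (1 - fps_X) ^ (n + 1) * Abs_fps (\<lambda>m. poly e (of_nat m))" by blast
  have *: "(1 - fps_X) * Abs_fps (\<lambda>m. poly d (of_nat m)) =
      fps_const (poly d 0) + fps_X * Abs_fps (\<lambda>m. poly e (of_nat m))"
    by (rule fps_ext)
       (auto simp: left_diff_distrib e_def poly_pcompose of_nat_diff not_le add.commute
             split: if_splits)
  define r where "r = smult (poly d 0) ([:1, -1:] ^ (n + 1)) + pCons 0 q"
  have "degree r \<le> Suc n"
    unfolding r_def
    by (intro degree_add_le order.trans[OF degree_smult_le] order.trans[OF degree_power_le]
        order.trans[OF degree_pCons_le]) (use q(1) in auto)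
  moreover have "fps_of_poly r = (1 - fps_X) ^ (Suc n + 1) * Abs_fps (\<lambda>m. poly d (of_nat m))"
  proof -
    have lin: "fps_of_poly [:1, -1:] = (1 - fps_X :: complex fps)"
      by (simp add: fps_of_poly_pCons)
    have "fps_of_poly r = (1 - fps_X) ^ (n + 1) *
        (fps_const (poly d 0) + fps_X * Abs_fps (\<lambda>m. poly e (of_nat m)))"
      unfolding r_def fps_of_poly_add fps_of_poly_smult fps_of_poly_power lin fps_of_poly_pCons q(2)
      by (simp add: algebra_simps)
    then show ?thesis unfolding *[symmetric] by (simp add: mult_ac)
  qed
  ultimately show ?case by blast
qed

lemma U_monom_props:
  assumes "p \<le> n"
  shows fps_of_poly_U_monom: "fps_of_poly (U_monom n p) =
      fps_const (1 / fact n) * (1 - fps_X) ^ (n + 1) * Abs_fps (\<lambda>m. of_nat m ^ p)" (is ?A)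
    and degree_U_monom: "degree (U_monom n p) \<le> n" (is ?B)
proof -
  obtain q where q: "degree q \<le> n"
    "fps_of_poly q = (1 - fps_X) ^ (n + 1) * Abs_fps (\<lambda>m. poly (monom 1 p) (of_nat m :: complex))"
    using generating_function_poly[of "monom 1 p" n] assms by (metis degree_monom_le order.trans)
  have "fps_of_poly (smult (1 / fact n) q) =
      fps_const (1 / fact n) * (1 - fps_X) ^ (n + 1) * Abs_fps (\<lambda>m. of_nat m ^ p)"
    using q(2) by (simp add: fps_of_poly_smult poly_monom mult_ac)
  then have "U_monom n p = smult (1 / fact n) q"
    unfolding U_monom_def by (intro the_equality) (auto simp flip: fps_of_poly_eq_iff)
  with q show ?A ?B by (simp_all add: fps_of_poly_smult poly_monom mult_ac)
qed

lemma fps_of_poly_U: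
  assumes "d \<in> poly_le n"
  shows "fps_of_poly (U n d) =
    fps_const (1 / fact n) * (1 - fps_X) ^ (n + 1) * Abs_fps (\<lambda>m. poly d (of_nat m))"
proof -
  have "fps_of_poly (U n d) = (\<Sum>p\<le>n. fps_const (coeff d p) *
      (fps_const (1 / fact n) * (1 - fps_X) ^ (n + 1) * Abs_fps (\<lambda>m. of_nat m ^ p)))"
    unfolding U_def fps_of_poly_sum fps_of_poly_smult
    by (intro sum.cong refl) (simp add: fps_of_poly_U_monom)
  also have "\<dots> = fps_const (1 / fact n) * (1 - fps_X) ^ (n + 1) *
      (\<Sum>p\<le>n. fps_const (coeff d p) * Abs_fps (\<lambda>m. of_nat m ^ p))"
    by (simp add: sum_distrib_left mult_ac)
  also have "(\<Sum>p\<le>n. fps_const (coeff d p) * Abs_fps (\<lambda>m. of_nat m ^ p)) =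
      Abs_fps (\<lambda>m. poly d (of_nat m))"
    using assms by (intro fps_ext) (simp add: fps_sum_nth poly_eq_sum_atMost poly_le_def)
  finally show ?thesis .
qed

lemma U_in: "U n d \<in> poly_le n"
  unfolding poly_le_def U_def mem_Collect_eq
  by (intro degree_sum_le) (simp_all add: degree_U_monom)

lemma U_factorial_basis:
  assumes "p \<le> n"
  defines "b \<equiv> (\<Prod>k<p. [:- of_nat k, 1:]) * pochhammer [:1, 1:] (n - p)"
  shows "b \<in> poly_le n" "U n b = monom 1 p"
proof -
  have "degree (\<Prod>k<p. [:- of_nat k, 1:] :: complex poly) \<le> p"
    by (rule order.trans[OF degree_prod_sum_le]) auto
  moreover have "degree (pochhammer [:1, 1:] (n - p) :: complex poly) \<le> n - p"
    unfolding pochhammer_prod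
    by (rule order.trans[OF degree_prod_sum_le]) (auto simp: of_nat_poly)
  ultimately show b: "b \<in> poly_le n"
    using assms(1) degree_mult_le[of "\<Prod>k<p. [:- of_nat k, 1:] :: complex poly"
      "pochhammer [:1, 1:] (n - p)"] unfolding b_def poly_le_def by simp
  have ev: "poly b (of_nat m) = (if m < p then 0 else fact n * of_nat ((m - p + n) choose n))" for m
  proof (cases "m < p")
    case True
    then show ?thesis by (auto simp: b_def poly_prod intro!: prod_zero)
  next
    case False
    then obtain k where m: "m = k + p" by (metis add.commute le_Suc_ex not_less)
    have 1: "(\<Prod>i<p. of_nat m - of_nat i :: complex) * fact k = fact m"
    proof -
      have "(\<Prod>i<p. of_nat m - of_nat i :: complex) = pochhammer (of_nat k + 1) p"
        unfolding pochhammer_prod_rev m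
        by (rule prod.reindex_bij_witness[of _ "\<lambda>i. i - 1" "\<lambda>i. i + 1"]) (auto simp: of_nat_diff)
      then show ?thesis using pochhammer_product'[of "1 :: complex" k p]
        by (simp add: m flip: pochhammer_fact) (simp add: add.commute mult.commute)
    qed
    have 2: "poly (pochhammer [:1, 1:] (n - p)) (of_nat m :: complex) * fact m = fact (k + n)"
    proof -
      have "poly (pochhammer [:1, 1:] (n - p)) (of_nat m :: complex)
          = pochhammer (1 + of_nat m) (n - p)"
        by (simp add: pochhammer_prod poly_prod)
      moreover have "m + (n - p) = k + n" using m assms(1) by simp
      ultimately show ?thesis using pochhammer_product'[of "1 :: complex" m "n - p"]
        by (simp add: mult.commute flip: pochhammer_fact)
    qed
    have "poly b (of_nat m) * fact k * fact m = fact m * fact (k + n)"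
      by (subst 1[symmetric], subst 2[symmetric]) (simp add: b_def poly_prod)
    moreover have "(fact (k + n) :: complex) = fact n * of_nat ((k + n) choose n) * fact k"
      using arg_cong[OF binomial_fact_lemma[of n "k + n"], of "of_nat :: nat \<Rightarrow> complex"]
      by (simp add: mult_ac)
    ultimately have "poly b (of_nat m) * (fact k * fact m) =
        fact n * of_nat ((k + n) choose n) * (fact k * fact m)"
      by (simp only: mult_ac)
    then show ?thesis using m by simp
  qed
  have "(k + n) choose k = (k + n) choose n" for k
    using binomial_symmetric[of n "k + n"] by simp
  then have "inverse ((1 - fps_X) ^ (n + 1)) = Abs_fps (\<lambda>k. of_nat ((k + n) choose n) :: complex)"
    using one_minus_const_fps_X_neg_power'[of "n + 1" "1 :: complex"]
    by (simp add: add.commute del: power_Suc)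
  then have series: "(1 - fps_X) ^ (n + 1) * Abs_fps (\<lambda>k. of_nat ((k + n) choose n)) = (1 :: complex fps)"
    using inverse_mult_eq_1'[of "(1 - fps_X :: complex fps) ^ (n + 1)"]
    by (simp add: fps_nth_power_0 del: power_Suc)
  have "Abs_fps (\<lambda>m. poly b (of_nat m)) =
      fps_const (fact n) * (fps_X ^ p * Abs_fps (\<lambda>k. of_nat ((k + n) choose n)))"
    by (rule fps_ext) (simp add: ev fps_X_power_mult_nth)
  then have "fps_of_poly (U n b) = fps_const (1 / fact n) * fps_const (fact n) * fps_X ^ p *
      ((1 - fps_X) ^ (n + 1) * Abs_fps (\<lambda>k. of_nat ((k + n) choose n)))"
    by (simp only: fps_of_poly_U[OF b] mult_ac)
  also have "\<dots> = fps_of_poly (monom 1 p)"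
    unfolding series by (simp add: fps_of_poly_monom)
  finally show "U n b = monom 1 p" by simp
qed

lemma U_sum: "U n (\<Sum>k\<in>A. smult (a k) (f k)) = (\<Sum>k\<in>A. smult (a k) (U n (f k)))"
proof -
  have add: "U n (c + d) = U n c + U n d" for c d
    by (simp add: U_def smult_add_left sum.distrib)
  have smult: "U n (smult x c) = smult x (U n c)" for x c
    by (rule poly_eqI) (simp add: U_def coeff_sum sum_distrib_left mult.assoc)
  have "U n 0 = 0"
    by (simp add: U_def)
  then show ?thesis by (induction A rule: infinite_finite_induct) (simp_all add: add smult)
qed

lemma bij_betw_U: "bij_betw (U n) (poly_le n) (poly_le n)"
proof (intro bij_betw_imageI inj_onI antisym subsetI)
  fix c d assume cd: "c \<in> poly_le n" "d \<in> poly_le n" "U n c = U n d"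
  have nz: "fps_const (1 / fact n) * (1 - fps_X) ^ (n + 1) \<noteq> (0 :: complex fps)"
  proof
    assume "fps_const (1 / fact n) * (1 - fps_X) ^ (n + 1) = (0 :: complex fps)"
    then have "fps_nth (fps_const (1 / fact n) * (1 - fps_X) ^ (n + 1) :: complex fps) 0 = 0"
      by simp
    then show False by (simp add: fps_nth_power_0)
  qed
  have "Abs_fps (\<lambda>m. poly c (of_nat m)) = Abs_fps (\<lambda>m. poly d (of_nat m))"
    using trans[OF fps_of_poly_U[OF cd(1), unfolded cd(3), symmetric] fps_of_poly_U[OF cd(2)]]
    by (simp only: mult_left_cancel[OF nz])
  then have "poly (c - d) (of_nat m) = 0" for m
    by (simp add: fps_eq_iff)
  then have "range (of_nat :: nat \<Rightarrow> complex) \<subseteq> {x. poly (c - d) x = 0}" by auto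
  then have "infinite {x. poly (c - d) x = 0}"
    by (rule infinite_super) (simp add: range_inj_infinite inj_on_def)
  then have "c - d = 0" using poly_roots_finite by blast
  then show "c = d" by simp
next
  fix c assume "c \<in> U n ` poly_le n"
  then show "c \<in> poly_le n" using U_in by auto
next
  fix c assume c: "c \<in> poly_le n"
  define b :: "nat \<Rightarrow> complex poly" where
    "b p = (\<Prod>k<p. [:- of_nat k, 1:]) * pochhammer [:1, 1:] (n - p)" for p
  have b: "b p \<in> poly_le n" "U n (b p) = monom 1 p" if "p \<le> n" for p
    using U_factorial_basis[OF that] by (simp_all add: b_def)
  have "U n (\<Sum>p\<le>n. smult (coeff c p) (b p)) = (\<Sum>p\<le>n. smult (coeff c p) (monom 1 p))"
    unfolding U_sum by (intro sum.cong refl) (simp add: b)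
  also have "\<dots> = c"
    using poly_as_sum_of_monoms'[of c n] c by (simp add: poly_le_def smult_monom)
  finally have "U n (\<Sum>p\<le>n. smult (coeff c p) (b p)) = c" .
  moreover have "(\<Sum>p\<le>n. smult (coeff c p) (b p)) \<in> poly_le n"
    unfolding poly_le_def mem_Collect_eq
  proof (rule degree_sum_le)
    show "degree (smult (coeff c p) (b p)) \<le> n" if "p \<in> {..n}" for p
      using b(1)[of p] that degree_smult_le[of "coeff c p" "b p"] by (simp add: poly_le_def)
  qed simp
  ultimately show "c \<in> U n ` poly_le n"
    by (rule image_eqI[OF sym])
qed

lemma U_inv_monom:
  assumes "p \<le> n"
  shows "U_inv n (monom 1 p) = (\<Prod>k<p. [:- of_nat k, 1:]) * pochhammer [:1, 1:] (n - p)"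
  using U_factorial_basis[OF assms] bij_betw_U[of n]
  by (metis U_inv_def bij_betw_def inv_into_f_f)

lemma op_mat_U_inverse: "op_mat n (U n) * op_mat n (U_inv n) = 1\<^sub>m (n + 1)"
proof (rule eq_matI)
  fix i j assume "i < dim_row (1\<^sub>m (n + 1) :: complex mat)" "j < dim_col (1\<^sub>m (n + 1) :: complex mat)"
  then have ij: "i < n + 1" "j < n + 1" by simp_all
  define d where "d = U_inv n (monom 1 j)"
  have "monom 1 j \<in> poly_le n"
    using ij by (simp add: poly_le_def degree_monom_eq)
  then have d: "U n d = monom 1 j"
    using bij_betw_U[of n] unfolding d_def U_inv_def by (metis bij_betw_inv_into_right)
  have U_mon: "U n (monom 1 k) = U_monom n k" if "k \<le> n" for k
    using that by (simp add: U_def if_distrib[of "\<lambda>a. smult a _"] cong: if_cong)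
  have "(op_mat n (U n) * op_mat n (U_inv n)) $$ (i, j) =
      (\<Sum>k = 0..<n + 1. coeff (U n (monom 1 k)) i * coeff d k)"
    using ij by (simp add: op_mat_def scalar_prod_def d_def del: sum.op_ivl_Suc)
  also have "\<dots> = (\<Sum>k\<le>n. coeff d k * coeff (U_monom n k) i)"
    by (intro sum.cong) (auto simp: U_mon)
  also have "\<dots> = coeff (U n d) i"
    by (simp add: U_def coeff_sum)
  finally show "(op_mat n (U n) * op_mat n (U_inv n)) $$ (i, j) = 1\<^sub>m (n + 1) $$ (i, j)"
    using ij by (simp add: d)
qed (simp_all add: op_mat_def)

end

(* The substitution x \<mapsto> -x-1 sends the basis polynomial (x)_p [x+1]_{n-p} = U_n^{-1} x^p to
   (-1)^n times (x)_{n-p} [x+1]_p = U_n^{-1} x^{n-p}, so in the monomial basis U_n turns it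
   into (-1)^n times the reversal of coefficients. *)

theory Submission
  imports Defs
begin

lemma monom_in_poly_le: "p \<le> n \<Longrightarrow> monom 1 p \<in> poly_le n"
  by (simp add: poly_le_def degree_monom_eq)

lemma U_inv_in: "c \<in> poly_le n \<Longrightarrow> U_inv n c \<in> poly_le n"
  using bij_betw_U[of n] unfolding U_inv_def by (metis bij_betw_imp_surj_on inv_into_into)

lemma U_U_inv: "c \<in> poly_le n \<Longrightarrow> U n (U_inv n c) = c"
  using bij_betw_U[of n] unfolding U_inv_def by (metis bij_betw_inv_into_right)

lemma U_inv_eqI: "d \<in> poly_le n \<Longrightarrow> U n d = c \<Longrightarrow> U_inv n c = d"
  using bij_betw_U[of n] unfolding U_inv_def by (metis bij_betw_inv_into_left)

text \<open>Linearity of the inverse, which \<open>inv_into\<close> does not show directly: the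
  combination lies in \<open>poly_le n\<close> and the linear map \<open>U n\<close> sends it to
  \<open>c\<close>, so by injectivity on \<open>poly_le n\<close> it is the chosen preimage.\<close>

lemma U_inv_expand:
  assumes "c \<in> poly_le n"
  shows "U_inv n c = (\<Sum>p\<le>n. smult (coeff c p) (U_inv n (monom 1 p)))"
proof (rule U_inv_eqI)
  have "degree (smult (coeff c p) (U_inv n (monom 1 p))) \<le> n" if "p \<le> n" for p
    using U_inv_in[OF monom_in_poly_le[OF that]]
    by (auto simp: poly_le_def intro: order.trans[OF degree_smult_le])
  then show "(\<Sum>p\<le>n. smult (coeff c p) (U_inv n (monom 1 p))) \<in> poly_le n"
    unfolding poly_le_def mem_Collect_eq by (intro degree_sum_le) auto
  have "U n (\<Sum>p\<le>n. smult (coeff c p) (U_inv n (monom 1 p))) = (\<Sum>p\<le>n. monom (coeff c p) p)"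
    unfolding U_sum by (intro sum.cong refl) (simp add: U_U_inv monom_in_poly_le smult_monom)
  also have "\<dots> = c"
    using assms by (intro poly_as_sum_of_monoms') (simp add: poly_le_def)
  finally show "U n (\<Sum>p\<le>n. smult (coeff c p) (U_inv n (monom 1 p))) = c" .
qed

lemma pcompose_U_inv_monom:
  assumes "p \<le> n"
  shows "pcompose (U_inv n (monom 1 p)) [:-1, -1:] =
    smult ((-1) ^ n) (U_inv n (monom 1 (n - p)))"
proof -
  \<comment> \<open>Each factor x - k becomes -x-1-k = -(x+1+k), a factor of [x+1]_m; the m signs
    are collected in front.\<close>
  have falling: "(\<Prod>k<m. [:- of_nat k, 1:] :: complex poly) \<circ>\<^sub>p [:-1, -1:] =
      smult ((-1) ^ m) (pochhammer [:1, 1:] m)" for m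
  proof -
    have "[:- of_nat k, 1:] \<circ>\<^sub>p [:-1, -1:] = smult (-1 :: complex) ([:1, 1:] + of_nat k)" for k
      by (simp add: pcompose_pCons of_nat_poly)
    then show ?thesis
      by (simp only: pcompose_prod pochhammer_prod prod_smult) (simp add: lessThan_atLeast0)
  qed
  \<comment> \<open>Conversely x+1+k becomes -x+k = -(x-k), a factor of (x)_m.\<close>
  have rising: "(pochhammer [:1, 1:] m :: complex poly) \<circ>\<^sub>p [:-1, -1:] =
      smult ((-1) ^ m) (\<Prod>k<m. [:- of_nat k, 1:])" for m
  proof -
    have "([:1, 1:] + of_nat k) \<circ>\<^sub>p [:-1, -1:] = smult (-1 :: complex) [:- of_nat k, 1:]" for k
      by (simp add: pcompose_pCons of_nat_poly)
    then show ?thesis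
      by (simp only: pcompose_prod pochhammer_prod prod_smult) (simp add: lessThan_atLeast0)
  qed
  \<comment> \<open>The p falling and n-p rising factors together contribute (-1)^n, independent of
    p. As p \<le> n, also n - (n-p) = p, so the swapped product is the preimage of x^{n-p}.\<close>
  have "(-1 :: complex) ^ p * (-1) ^ (n - p) = (-1) ^ n"
    using assms by (simp flip: power_add)
  then show ?thesis
    using assms by (simp add: U_inv_monom pcompose_mult falling rising mult.commute)
qed

text \<open>By linearity it is enough to follow the basis: the preimage of x^p turns into (-1)^n
  times the preimage of x^{n-p}, and \<open>U n\<close> maps the latter back to x^{n-p}.\<close>

lemma U_pcompose_U_inv:
  assumes "c \<in> poly_le n"
  shows "U n (pcompose (U_inv n c) [:-1, -1:]) = smult ((-1) ^ n) (J n c)"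
proof -
  have "pcompose (U_inv n c) [:-1, -1:] =
      (\<Sum>p\<le>n. smult ((-1) ^ n * coeff c p) (U_inv n (monom 1 (n - p))))"
    unfolding U_inv_expand[OF assms] pcompose_sum pcompose_smult
    by (intro sum.cong refl) (simp add: pcompose_U_inv_monom mult.commute)
  then have "U n (pcompose (U_inv n c) [:-1, -1:]) =
      (\<Sum>p\<le>n. smult ((-1) ^ n * coeff c p) (monom 1 (n - p)))"
    by (simp add: U_sum U_U_inv monom_in_poly_le)
  also have "\<dots> = smult ((-1) ^ n) (J n c)"
    by (rule poly_eqI) (simp add: J_def coeff_sum sum_distrib_left if_distrib cong: if_cong)
  finally show ?thesis .
qed

text \<open>Column j of the product applies \<open>S\<close> to the monomial expansion of
  \<open>T (monom 1 j)\<close>. The degree bound on this image matters because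
  \<open>op_mat n\<close> cuts off coefficients beyond x^n. Linearity of \<open>S\<close> is stated
  in the form of \<open>U_sum\<close>.\<close>

lemma op_mat_mult:
  assumes S: "\<And>(a :: nat \<Rightarrow> complex) f A. S (\<Sum>k\<in>A. smult (a k) (f k)) = (\<Sum>k\<in>A. smult (a k) (S (f k)))"
    and T: "\<And>j. j \<le> n \<Longrightarrow> T (monom 1 j) \<in> poly_le n"
  shows "op_mat n S * op_mat n T = op_mat n (\<lambda>c. S (T c))"
proof (rule eq_matI)
  fix i j assume "i < dim_row (op_mat n (\<lambda>c. S (T c)))" "j < dim_col (op_mat n (\<lambda>c. S (T c)))"
  then have ij: "i < n + 1" "j < n + 1" by (simp_all add: op_mat_def)
  define c where "c = T (monom 1 j)"
  have "degree c \<le> n"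
    using T[of j] ij by (simp add: c_def poly_le_def)
  then have "c = (\<Sum>k\<le>n. smult (coeff c k) (monom 1 k))"
    using poly_as_sum_of_monoms'[of c n] by (simp add: smult_monom)
  then have "S c = (\<Sum>k\<le>n. smult (coeff c k) (S (monom 1 k)))"
    using S[of "coeff c" "monom 1" "{..n}"] by simp
  moreover have "(op_mat n S * op_mat n T) $$ (i, j) =
      (\<Sum>k = 0..<n + 1. coeff (S (monom 1 k)) i * coeff c k)"
    using ij by (simp add: op_mat_def scalar_prod_def c_def del: sum.op_ivl_Suc)
  moreover have "\<dots> = (\<Sum>k\<le>n. coeff c k * coeff (S (monom 1 k)) i)"
    by (intro sum.cong) auto
  ultimately show "(op_mat n S * op_mat n T) $$ (i, j) = op_mat n (\<lambda>c. S (T c)) $$ (i, j)"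
    using ij by (simp add: op_mat_def coeff_sum flip: c_def)
qed (simp_all add: op_mat_def)

theorem theorem2p1:
  fixes n :: nat
  shows "(\<forall>c \<in> poly_le n. let d = U_inv n c in
            \<forall>x. x \<noteq> 0 \<longrightarrow>
              poly (U n (pcompose d [:-1, -1:])) x = (-1) ^ n * (x ^ n * poly c (1 / x)))
       \<and> op_mat n (U n) * op_mat n shift * op_mat n neg_arg * op_mat n (U_inv n)
           = (-1) ^ n \<cdot>\<^sub>m op_mat n (J n)"
proof
  show "\<forall>c \<in> poly_le n. let d = U_inv n c in
            \<forall>x. x \<noteq> 0 \<longrightarrow>
              poly (U n (pcompose d [:-1, -1:])) x = (-1) ^ n * (x ^ n * poly c (1 / x))"
    \<comment> \<open>\<open>poly_J\<close> needs x \<noteq> 0: with the convention 1/0 = 0, the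
      expression x^n c(1/x) at 0 would in general miss the leading coefficient.\<close>
    by (simp add: U_pcompose_U_inv poly_J)
  have shift: "shift (monom 1 j) \<in> poly_le n" and neg: "neg_arg (monom 1 j) \<in> poly_le n"
    if "j \<le> n" for j
    using that by (simp_all add: shift_def neg_arg_def poly_le_def degree_pcompose degree_monom_eq)
  \<comment> \<open>Multiplying from the left keeps each left factor a composite of maps linear on
    all polynomials; \<open>U_inv n\<close> enters last, on the right, where only its values on
    monomials occur.\<close>
  have "op_mat n (U n) * op_mat n shift = op_mat n (\<lambda>c. U n (shift c))"
    by (rule op_mat_mult) (simp_all add: U_sum shift)
  also have "\<dots> * op_mat n neg_arg = op_mat n (\<lambda>c. U n (shift (neg_arg c)))"
    by (rule op_mat_mult) (simp_all add: neg, simp add: shift_def pcompose_sum pcompose_smult U_sum)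
  also have "\<dots> * op_mat n (U_inv n) = op_mat n (\<lambda>c. U n (shift (neg_arg (U_inv n c))))"
    by (rule op_mat_mult)
       (simp_all add: shift_def neg_arg_def pcompose_sum pcompose_smult U_sum U_inv_in monom_in_poly_le)
  also have "\<dots> = (-1) ^ n \<cdot>\<^sub>m op_mat n (J n)"
  proof -
    \<comment> \<open>The order matters: c(-x) followed by x \<mapsto> x+1 gives c(-x-1), whereas
      the reverse order would give c(1-x).\<close>
    have "shift (neg_arg c) = pcompose c [:-1, -1:]" for c
      by (simp add: shift_def neg_arg_def pcompose_pCons flip: pcompose_assoc)
    then show ?thesis
      by (intro eq_matI) (simp_all add: op_mat_def U_pcompose_U_inv monom_in_poly_le)
  qed
  finally show "op_mat n (U n) * op_mat n shift * op_mat n neg_arg * op_mat n (U_inv n)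
      = (-1) ^ n \<cdot>\<^sub>m op_mat n (J n)" .
qed

end
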